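(* Let $G$ be a connected $(2K_2, C_4, C_5)$-free graph and let $S$ be any minimal vertex separator of $G$. Then: (i) if $G$ is a complete graph, then $V(G)\setminus\{x,y\}$ is a minimum feedback vertex set of $G$ for some $x,y\in V(G)$; (ii) if $G-S$ has only trivial components, then $S\setminus\{v\}$ is a minimum feedback vertex set of $G$ for some $v\in S$; (iii) if $G-S$ has a non-trivial component $G_1$ which is a tree: if there is a vertex $v\in S$ with $|N_G(v)\cap V(G_1)|=1$, then $S\setminus\{v\}$ is a minimum feedback vertex set of $G$; if every vertex $v\in S$ satisfies $|N_G(v)\cap V(G_1)|\ge 2$, then $S$ is a minimum feedback vertex set of $G$; (iv) if $G-S$ has a non-trivial component $G_1$ containing at least one cycle, then the size of a minimum feedback vertex set of $G$ equals $\min_{j\in S}\big(|S\setminus\{j\}| + \mathrm{fvs}(G[V(G_1)\cup\{j\}])\big)$.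
   Context: A graph is $(H_1,\dots,H_r)$-free if it contains none of $H_1,\dots,H_r$ as an induced subgraph; $2K_2$ is two disjoint edges, $C_n$ the $n$-cycle. A minimal vertex separator of a connected graph $G$ is a set $S\subseteq V(G)$ such that $G-S$ is disconnected, and no proper subset of $S$ has this property. A component of $G-S$ is trivial if it has a single vertex, non-trivial otherwise. A feedback vertex set of $G$ is a set $F$ with $G-F$ a forest; $\mathrm{fvs}(H)$ denotes the minimum size of a feedback vertex set of $H$, and $G[X]$ the subgraph induced on $X$. $N_G(v)$ is the neighbourhood of $v$. *)

theory Defs
  imports
    "Graph_Theory.Digraph_Component"
    "Graph_Theory.Digraph_Isomorphism"
    "Graph_Theory.Kuratowski"
begin

text \<open>
  Finite simple graphs are the symmetric digraphs of the locale \<^locale>\<open>graph\<close>: every edge is a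
  pair of opposite arcs. For such graphs the strongly connected components
  \<^term>\<open>pre_digraph.sccs G\<close> are the connected components, and \<^const>\<open>complete_digraph\<close>
  describes the complete graphs. Going back and forth along one edge is however a
  \<^const>\<open>pre_digraph.cycle\<close> (of length 2), so the library's \<^const>\<open>forest\<close> and
  \<^const>\<open>tree\<close> would only admit graphs without edges. Undirected cycles have length at least 3.
\<close>

definition graph_cycle :: "('a, 'b) pre_digraph \<Rightarrow> 'b awalk \<Rightarrow> bool" where
  "graph_cycle G p \<longleftrightarrow> pre_digraph.cycle G p \<and> 3 \<le> length p"

definition graph_forest :: "('a, 'b) pre_digraph \<Rightarrow> bool" where
  "graph_forest G \<longleftrightarrow> \<not> (\<exists>p. graph_cycle G p)"

definition graph_tree :: "('a, 'b) pre_digraph \<Rightarrow> bool" where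
  "graph_tree G \<longleftrightarrow> connected G \<and> graph_forest G"

definition delete_verts :: "('a, 'b) pre_digraph \<Rightarrow> 'a set \<Rightarrow> ('a, 'b) pre_digraph" where
  "delete_verts G X = G \<restriction> (verts G - X)"

definition neighbourhood :: "('a, 'b) pre_digraph \<Rightarrow> 'a \<Rightarrow> 'a set" where
  "neighbourhood G v = {u. v \<rightarrow>\<^bsub>G\<^esub> u}"

definition induced_free :: "('c, 'd) pre_digraph \<Rightarrow> ('a, 'b) pre_digraph \<Rightarrow> bool" where
  "induced_free H G \<longleftrightarrow> \<not> (\<exists>H'. induced_subgraph H' G \<and> digraph_iso H' H)"

definition two_K2 :: "nat pair_pre_digraph" where
  "two_K2 = \<lparr> pverts = {0, 1, 2, 3}, parcs = {(0, 1), (1, 0), (2, 3), (3, 2)} \<rparr>"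

definition cycle_graph :: "nat \<Rightarrow> nat pair_pre_digraph" where
  "cycle_graph n = \<lparr> pverts = {0..<n},
     parcs = {(i, j). i < n \<and> j < n \<and> (j = Suc i mod n \<or> i = Suc j mod n)} \<rparr>"

text \<open>
  \<^const>\<open>connected\<close> fails for the null graph, which is nevertheless not disconnected; without the
  condition \<^prop>\<open>S \<noteq> verts G\<close> the whole vertex set would separate every complete graph.
\<close>

definition vertex_separator :: "('a, 'b) pre_digraph \<Rightarrow> 'a set \<Rightarrow> bool" where
  "vertex_separator G S \<longleftrightarrow>
     S \<subseteq> verts G \<and> S \<noteq> verts G \<and> \<not> connected (delete_verts G S)"

definition minimal_vertex_separator :: "('a, 'b) pre_digraph \<Rightarrow> 'a set \<Rightarrow> bool" where
  "minimal_vertex_separator G S \<longleftrightarrow>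
     vertex_separator G S \<and> (\<forall>T. T \<subset> S \<longrightarrow> \<not> vertex_separator G T)"

definition trivial_component :: "('a, 'b) pre_digraph \<Rightarrow> bool" where
  "trivial_component C \<longleftrightarrow> card (verts C) = 1"

definition feedback_vertex_set :: "('a, 'b) pre_digraph \<Rightarrow> 'a set \<Rightarrow> bool" where
  "feedback_vertex_set G F \<longleftrightarrow> F \<subseteq> verts G \<and> graph_forest (delete_verts G F)"

definition minimum_fvs :: "('a, 'b) pre_digraph \<Rightarrow> 'a set \<Rightarrow> bool" where
  "minimum_fvs G F \<longleftrightarrow>
     feedback_vertex_set G F \<and> (\<forall>F'. feedback_vertex_set G F' \<longrightarrow> card F \<le> card F')"

definition fvs :: "('a, 'b) pre_digraph \<Rightarrow> nat" where
  "fvs G = (LEAST k. \<exists>F. feedback_vertex_set G F \<and> card F = k)"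

end

theory Submission
  imports Defs
begin

unbundle no funcset_syntax

text \<open>
  Minimality makes every vertex of \<open>S\<close> adjacent to every component of \<open>G - S\<close>, and
  \<open>2K\<^sub>2\<close>-freeness leaves at most one nontrivial component; so \<open>G - S\<close> has an isolated vertex
  \<open>t\<close>, whose neighbourhood is exactly \<open>S\<close>. Looking at two non-adjacent vertices of \<open>S\<close>, their
  common neighbour \<open>t\<close> and their neighbours in another component, one finds an induced
  \<open>2K\<^sub>2\<close>, \<open>C\<^sub>4\<close> or \<open>C\<^sub>5\<close>; hence \<open>S \<union> {t}\<close> is a clique and a feedback vertex set omits at
  most two of its elements. Conversely, once all but one vertex of \<open>S\<close> are deleted, the isolated
  vertices of \<open>G - S\<close> have degree at most one and lie on no cycle, so only the nontrivial component
  together with the remaining vertex of \<open>S\<close> matters.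
\<close>

section \<open>Induced subgraphs\<close>

lemma induce_subgraph_induce: "B \<subseteq> A \<Longrightarrow> (G \<restriction> A) \<restriction> B = G \<restriction> B"
  by (auto simp: induce_subgraph_def)

lemma dominates_induce_iff: "u \<rightarrow>\<^bsub>G \<restriction> X\<^esub> v \<longleftrightarrow> u \<in> X \<and> v \<in> X \<and> u \<rightarrow>\<^bsub>G\<^esub> v"
  by (auto simp: arcs_ends_conv)

lemma (in wf_digraph) induce_verts: "G \<restriction> verts G = G"
  by (intro pre_digraph.equality) auto

lemma induced_subgraph_eq_induce:
  assumes "induced_subgraph H G" shows "H = G \<restriction> verts H"
  using assms by (auto simp: induced_subgraph_def subgraph_def compatible_def induce_subgraph_def)

lemma (in sym_digraph) sym_digraph_induce: "X \<subseteq> verts G \<Longrightarrow> sym_digraph (G \<restriction> X)"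
  by (simp add: induced_graph_imp_graph induced_induce)

text \<open>\<open>connected\<close> is stated through the symmetric closure, which changes nothing
  when the arcs are already symmetric.\<close>

lemma (in sym_digraph) connected_iff_reachable:
  "connected G \<longleftrightarrow> verts G \<noteq> {} \<and> (\<forall>u\<in>verts G. \<forall>v\<in>verts G. u \<rightarrow>\<^sup>* v)"
  by (simp add: connected_def strongly_connected_def reachable_mk_symmetric_eq[OF sym_arcs])

text \<open>Reduces freeness to adjacency between named vertices. An arc is sent to the pair of
  preimages of its ends, which is injective because there are no parallel arcs. The isomorphism runs
  from the induced subgraph to \<open>H\<close>, hence the inverse of \<open>f\<close>.\<close>

lemma (in nomulti_digraph) embedding_imp_not_induced_free:
  assumes pverts: "pverts H = A" and inj: "inj_on f A" and sub: "f ` A \<subseteq> verts G"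
    and edges: "\<forall>i\<in>A. \<forall>j\<in>A. f i \<rightarrow> f j \<longleftrightarrow> (i, j) \<in> parcs H"
    and wf: "parcs H \<subseteq> A \<times> A"
  shows "\<not> induced_free (with_proj H) G"
proof -
  let ?K = "G \<restriction> (f ` A)"
  let ?g = "inv_into A f"
  let ?hom = "\<lparr>iso_verts = ?g, iso_arcs = \<lambda>e. (?g (tail G e), ?g (head G e)),
    iso_head = snd, iso_tail = fst\<rparr>"
  have ind: "induced_subgraph ?K G"
    using sub by (rule induced_induce)
  have g: "inj_on ?g (f ` A)" "?g ` f ` A = A"
    using inj by (auto intro: inj_on_inv_into simp: inv_into_f_f)
  have "inj_on (\<lambda>e. (?g (tail G e), ?g (head G e))) (arcs ?K)"
  proof (rule inj_onI)
    fix e1 e2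
    assume e: "e1 \<in> arcs ?K" "e2 \<in> arcs ?K"
      and eq: "(?g (tail G e1), ?g (head G e1)) = (?g (tail G e2), ?g (head G e2))"
    have "tail G e1 = tail G e2" "head G e1 = head G e2"
      using e eq inj_onD[OF g(1)] by auto
    then show "e1 = e2"
      using e by (intro no_multi_arcs) (auto simp: arc_to_ends_def)
  qed
  then have "pre_digraph.digraph_isomorphism ?K ?hom"
    using g by (auto simp: pre_digraph.digraph_isomorphism_def wf_digraphI_induced[OF ind])
  moreover have "with_proj H = app_iso ?hom ?K"
  proof -
    have "parcs H = (\<lambda>e. (?g (tail G e), ?g (head G e))) ` arcs ?K"
    proof (intro set_eqI iffI)
      fix x assume x: "x \<in> parcs H"
      then obtain i j where ij: "x = (i, j)" "i \<in> A" "j \<in> A"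
        using wf by auto
      with x edges have "f i \<rightarrow> f j" by auto
      then obtain e where "e \<in> arcs G" "tail G e = f i" "head G e = f j" by auto
      then show "x \<in> (\<lambda>e. (?g (tail G e), ?g (head G e))) ` arcs ?K"
        using ij inj by (auto intro!: rev_image_eqI[of e])
    next
      fix x assume "x \<in> (\<lambda>e. (?g (tail G e), ?g (head G e))) ` arcs ?K"
      then obtain e i j where e: "e \<in> arcs G" "x = (?g (tail G e), ?g (head G e))"
        and ij: "i \<in> A" "j \<in> A" "tail G e = f i" "head G e = f j"
        by auto
      then have "f i \<rightarrow> f j" using in_arcs_imp_in_arcs_ends by metis
      then show "x \<in> parcs H" using e ij inj edges by auto
    qed
    then show ?thesis
      using g by (simp add: pverts with_proj_def app_iso_def)
  qed
  ultimately show ?thesis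
    using ind unfolding induced_free_def digraph_iso_def by blast
qed

lemma (in graph) two_K2_free:
  assumes "induced_free (with_proj two_K2) G"
    and "a \<rightarrow> b" "c \<rightarrow> d"
    and "a \<noteq> c" "a \<noteq> d" "b \<noteq> c" "b \<noteq> d"
  shows "a \<rightarrow> c \<or> a \<rightarrow> d \<or> b \<rightarrow> c \<or> b \<rightarrow> d"
proof (rule ccontr)
  assume no: "\<not> ?thesis"
  \<comment> \<open>Indexing into the list assigns a vertex of \<open>G\<close> to each number of
    the forbidden graph; the two cycle lemmas use the same device.\<close>
  let ?f = "(!) [a, b, c, d]"
  have loops: "(x, x) \<notin> arcs_ends G" for x using adj_not_same by auto
  have ne: "a \<noteq> b" "c \<noteq> d"
    using assms adj_not_same by auto
  have flip: "b \<rightarrow> a" "d \<rightarrow> c"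
    using assms graph_symmetric by auto
  have no_flip: "\<not> c \<rightarrow> a" "\<not> d \<rightarrow> a" "\<not> c \<rightarrow> b" "\<not> d \<rightarrow> b"
    using no graph_symmetric by blast+
  have pverts: "pverts two_K2 = {0, 1, 2, 3}"
    by (auto simp: two_K2_def)
  have edges: "\<forall>i\<in>{0, 1, 2, 3}. \<forall>j\<in>{0, 1, 2, 3}. ?f i \<rightarrow> ?f j \<longleftrightarrow> (i, j) \<in> parcs two_K2"
    using no ne assms(2-) by (simp add: two_K2_def flip no_flip loops)
  have inj: "inj_on ?f {0, 1, 2, 3}"
    using ne assms(2-) by (simp add: inj_on_def)
  have sub: "?f ` {0, 1, 2, 3} \<subseteq> verts G"
    using assms(2-3) by (auto dest: adj_in_verts)
  have wf: "parcs two_K2 \<subseteq> {0, 1, 2, 3} \<times> {0, 1, 2, 3}"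
    unfolding pverts[symmetric] by (auto simp: two_K2_def)
  have "\<not> induced_free (with_proj two_K2) G"
    by (rule embedding_imp_not_induced_free[OF pverts inj sub edges wf])
  then show False using assms(1) by simp
qed

lemma (in graph) cycle_graph_4_free:
  assumes "induced_free (with_proj (cycle_graph 4)) G"
    and "a \<rightarrow> b" "b \<rightarrow> c" "c \<rightarrow> d" "d \<rightarrow> a"
    and "a \<noteq> c" "b \<noteq> d"
  shows "a \<rightarrow> c \<or> b \<rightarrow> d"
proof (rule ccontr)
  assume no: "\<not> ?thesis"
  let ?f = "(!) [a, b, c, d]"
  have loops: "(x, x) \<notin> arcs_ends G" for x using adj_not_same by auto
  have ne: "a \<noteq> b" "b \<noteq> c" "c \<noteq> d" "d \<noteq> a"
    using assms adj_not_same by auto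
  have flip: "b \<rightarrow> a" "c \<rightarrow> b" "d \<rightarrow> c" "a \<rightarrow> d"
    using assms graph_symmetric by auto
  have no_flip: "\<not> c \<rightarrow> a" "\<not> d \<rightarrow> b"
    using no graph_symmetric by blast+
  have pverts: "pverts (cycle_graph 4) = {0, 1, 2, 3}"
    by (auto simp: cycle_graph_def)
  have edges: "\<forall>i\<in>{0, 1, 2, 3}. \<forall>j\<in>{0, 1, 2, 3}. ?f i \<rightarrow> ?f j \<longleftrightarrow> (i, j) \<in> parcs (cycle_graph 4)"
    using no ne assms(2-) by (simp add: cycle_graph_def flip no_flip loops)
  have inj: "inj_on ?f {0, 1, 2, 3}"
    using ne assms(2-) by (simp add: inj_on_def)
  have sub: "?f ` {0, 1, 2, 3} \<subseteq> verts G"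
    using assms(2-5) by (auto dest: adj_in_verts)
  have wf: "parcs (cycle_graph 4) \<subseteq> {0, 1, 2, 3} \<times> {0, 1, 2, 3}"
    unfolding pverts[symmetric] by (auto simp: cycle_graph_def)
  have "\<not> induced_free (with_proj (cycle_graph 4)) G"
    by (rule embedding_imp_not_induced_free[OF pverts inj sub edges wf])
  then show False using assms(1) by simp
qed

lemma (in graph) cycle_graph_5_free:
  assumes "induced_free (with_proj (cycle_graph 5)) G"
    and "a \<rightarrow> b" "b \<rightarrow> c" "c \<rightarrow> d" "d \<rightarrow> e" "e \<rightarrow> a"
    and "a \<noteq> c" "a \<noteq> d" "b \<noteq> d" "b \<noteq> e" "c \<noteq> e"
  shows "a \<rightarrow> c \<or> a \<rightarrow> d \<or> b \<rightarrow> d \<or> b \<rightarrow> e \<or> c \<rightarrow> e"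
proof (rule ccontr)
  assume no: "\<not> ?thesis"
  let ?f = "(!) [a, b, c, d, e]"
  have loops: "(x, x) \<notin> arcs_ends G" for x using adj_not_same by auto
  have ne: "a \<noteq> b" "b \<noteq> c" "c \<noteq> d" "d \<noteq> e" "e \<noteq> a"
    using assms adj_not_same by auto
  have flip: "b \<rightarrow> a" "c \<rightarrow> b" "d \<rightarrow> c" "e \<rightarrow> d" "a \<rightarrow> e"
    using assms graph_symmetric by auto
  have no_flip: "\<not> c \<rightarrow> a" "\<not> d \<rightarrow> a" "\<not> d \<rightarrow> b" "\<not> e \<rightarrow> b" "\<not> e \<rightarrow> c"
    using no graph_symmetric by blast+
  have pverts: "pverts (cycle_graph 5) = {0, 1, 2, 3, 4}"
    by (auto simp: cycle_graph_def)
  have edges: "\<forall>i\<in>{0, 1, 2, 3, 4}. \<forall>j\<in>{0, 1, 2, 3, 4}. ?f i \<rightarrow> ?f j \<longleftrightarrow> (i, j) \<in> parcs (cycle_graph 5)"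
    using no ne assms(2-) by (simp add: cycle_graph_def flip no_flip loops)
  have inj: "inj_on ?f {0, 1, 2, 3, 4}"
    using ne assms(2-) by (simp add: inj_on_def)
  have sub: "?f ` {0, 1, 2, 3, 4} \<subseteq> verts G"
    using assms(2-6) by (auto dest: adj_in_verts)
  have wf: "parcs (cycle_graph 5) \<subseteq> {0, 1, 2, 3, 4} \<times> {0, 1, 2, 3, 4}"
    unfolding pverts[symmetric] by (auto simp: cycle_graph_def)
  have "\<not> induced_free (with_proj (cycle_graph 5)) G"
    by (rule embedding_imp_not_induced_free[OF pverts inj sub edges wf])
  then show False using assms(1) by simp
qed

section \<open>Cycles\<close>

text \<open>Keeps all cycles in \<open>G\<close> while the vertex set varies. The tails of the arcs
  of a closed walk are all its vertices.\<close>

definition (in pre_digraph) cycle_within :: "'a set \<Rightarrow> bool" where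
  "cycle_within X \<longleftrightarrow> (\<exists>p. graph_cycle G p \<and> tail G ` set p \<subseteq> X)"

lemma fvs_le: "feedback_vertex_set H F \<Longrightarrow> fvs H \<le> card F"
  unfolding fvs_def by (rule Least_le) auto

text \<open>Shows that the \<open>LEAST\<close> in \<open>fvs\<close> ranges over a nonempty set: a
  walk needs a start vertex, so no cycle survives the deletion of everything.\<close>

lemma feedback_vertex_set_verts: "feedback_vertex_set H (verts H)"
proof -
  have "\<not> pre_digraph.awalk (delete_verts H (verts H)) u p v" for u p v
    by (simp add: delete_verts_def pre_digraph.awalk_def)
  then show ?thesis
    by (auto simp: feedback_vertex_set_def graph_forest_def graph_cycle_def pre_digraph.cycle_def)
qed

lemma fvs_attained: obtains F where "feedback_vertex_set H F" "card F = fvs H"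
proof -
  have "\<exists>F. feedback_vertex_set H F \<and> card F = fvs H"
    unfolding fvs_def by (rule LeastI_ex) (use feedback_vertex_set_verts in blast)
  then show thesis using that by blast
qed

section \<open>Cycles and feedback vertex sets of induced subgraphs\<close>

context wf_digraph
begin

text \<open>Reading a closed walk by tails or by heads gives the same vertices, shifted by one
  position.\<close>

lemma closed_walk_verts:
  assumes "awalk u p u" "p \<noteq> []"
  shows "awalk_verts u p = map (tail G) p @ [u]" "awalk_verts u p = u # map (head G) p"
    "u \<in> tail G ` set p"
proof -
  have *: "cas u p u" "awlast u p = u" using assms by auto
  show 1: "awalk_verts u p = map (tail G) p @ [u]"
    using assms *(2) by (simp add: awalk_verts_conv)
  have "u = tail G (hd p)" using assms by (cases p) (auto simp: awalk_def)
  then show "awalk_verts u p = u # map (head G) p" "u \<in> tail G ` set p"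
    using assms awalk_verts_conv'[OF *(1)] by auto
qed

lemma graph_cycle_induce_iff:
  assumes "X \<subseteq> verts G"
  shows "graph_cycle (G \<restriction> X) p \<longleftrightarrow> graph_cycle G p \<and> tail G ` set p \<subseteq> X"
proof
  assume L: "graph_cycle (G \<restriction> X) p"
  then have "cycle p"
    using assms by (auto simp: graph_cycle_def intro: subgraph_cycle subgraph_induce_subgraphI)
  moreover have "set p \<subseteq> arcs (G \<restriction> X)"
    using L by (auto simp: graph_cycle_def pre_digraph.cycle_def pre_digraph.awalk_def)
  ultimately show "graph_cycle G p \<and> tail G ` set p \<subseteq> X"
    using L by (auto simp: graph_cycle_def)
next
  assume R: "graph_cycle G p \<and> tail G ` set p \<subseteq> X"
  then obtain u where u: "awalk u p u" "distinct (tl (awalk_verts u p))" "p \<noteq> []"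
    by (auto simp: graph_cycle_def cycle_def)
  then have "set (awalk_verts u p) \<subseteq> X"
    using R closed_walk_verts[OF u(1,3)] by auto
  then have "pre_digraph.awalk (G \<restriction> X) u p u" using u awalk_induce by auto
  then have "pre_digraph.cycle (G \<restriction> X) p"
    using u by (auto simp: pre_digraph.cycle_def awalk_verts_induce)
  then show "graph_cycle (G \<restriction> X) p" using R by (simp add: graph_cycle_def)
qed

lemma graph_forest_induce_iff:
  "X \<subseteq> verts G \<Longrightarrow> graph_forest (G \<restriction> X) \<longleftrightarrow> \<not> cycle_within X"
  by (auto simp: graph_forest_def cycle_within_def graph_cycle_induce_iff)

lemma cycle_within_mono: "cycle_within X \<Longrightarrow> X \<subseteq> Y \<Longrightarrow> cycle_within Y"
  by (auto simp: cycle_within_def)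

lemma not_cycle_within_empty: "\<not> cycle_within {}"
  by (auto simp: cycle_within_def graph_cycle_def)

lemma feedback_vertex_set_induce_iff:
  assumes "X \<subseteq> verts G"
  shows "feedback_vertex_set (G \<restriction> X) F \<longleftrightarrow> F \<subseteq> X \<and> \<not> cycle_within (X - F)"
proof -
  have "delete_verts (G \<restriction> X) F = G \<restriction> (X - F)"
    by (simp add: delete_verts_def induce_subgraph_induce)
  moreover have "X - F \<subseteq> verts G" using assms by auto
  ultimately show ?thesis by (simp add: feedback_vertex_set_def graph_forest_induce_iff)
qed

lemma feedback_vertex_set_iff:
  "feedback_vertex_set G F \<longleftrightarrow> F \<subseteq> verts G \<and> \<not> cycle_within (verts G - F)"
  using feedback_vertex_set_induce_iff[of "verts G"] by (simp add: induce_verts)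

end

section \<open>Pruning and constructing cycles in simple graphs\<close>

context graph
begin

text \<open>The two neighbours are the vertices just before and just after \<open>v\<close> on the
  cycle.\<close>

lemma graph_cycle_two_neighbours:
  assumes "graph_cycle G p" "v \<in> tail G ` set p"
  obtains x y where "x \<in> tail G ` set p" "y \<in> tail G ` set p" "x \<noteq> y" "v \<rightarrow> x" "v \<rightarrow> y"
proof -
  define n where "n = length p"
  obtain u where u: "awalk u p u" "distinct (tl (awalk_verts u p))" and n: "3 \<le> n"
    using assms by (auto simp: graph_cycle_def cycle_def n_def)
  then have "p \<noteq> []" by (auto simp: n_def)
  note vs = closed_walk_verts[OF u(1) this]
  have eq: "map (tail G) p @ [u] = u # map (head G) p" using vs by simp
  have dist: "distinct (map (head G) p)" using u(2) vs(2) by simp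
  have tl: "tail G (p ! Suc i) = head G (p ! i)" if "Suc i < n" for i
    using arg_cong[OF eq, of "\<lambda>xs. xs ! Suc i"] that by (simp add: nth_append n_def)
  have "tail G (p ! 0) = u"
    using arg_cong[OF eq, of hd] \<open>p \<noteq> []\<close> by (simp add: hd_append hd_map hd_conv_nth)
  moreover have "head G (p ! (n - 1)) = u"
    using arg_cong[OF eq, of last] \<open>p \<noteq> []\<close>
    by (simp add: last_map last_conv_nth n_def)
  ultimately have t0: "tail G (p ! 0) = head G (p ! (n - 1))" by simp
  have sets: "tail G ` set p = head G ` set p"
  proof -
    have "insert u (tail G ` set p) = insert u (head G ` set p)"
      using arg_cong[OF eq, of set] by simp
    moreover have "u \<in> head G ` set p"
      using \<open>head G (p ! (n - 1)) = u\<close> n by (auto simp: n_def intro!: image_eqI[of _ _ "p ! (n-1)"])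
    ultimately show ?thesis using vs(3) by auto
  qed
  obtain i where i: "i < n" "v = head G (p ! i)"
    using assms(2) unfolding sets by (auto simp: in_set_conv_nth n_def)
  \<comment> \<open>\<open>j\<close> and \<open>k\<close> are the cyclic successor and predecessor
    of the position \<open>i\<close> whose arc enters \<open>v\<close>. They differ because the
    length is at least 3; on a walk back and forth along one edge they would coincide.\<close>
  define j where "j = (if Suc i = n then 0 else Suc i)"
  define k where "k = (if i = 0 then n - 1 else i - 1)"
  have jk: "j < n" "k < n" "j \<noteq> k" using n i by (auto simp: j_def k_def)
  have arcs: "p ! l \<in> arcs G" if "l < n" for l
    using u(1) that nth_mem[of l p] by (auto simp: n_def awalk_def)
  have "tail G (p ! j) = v" using tl t0 i by (auto simp: j_def)
  then have vj: "v \<rightarrow> head G (p ! j)"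
    using in_arcs_imp_in_arcs_ends[OF arcs[OF jk(1)]] by simp
  have "tail G (p ! i) = head G (p ! k)" using tl[of "i - 1"] t0 i by (auto simp: k_def)
  then have vk: "v \<rightarrow> head G (p ! k)"
    using in_arcs_imp_in_arcs_ends[OF arcs[OF i(1)]] i graph_symmetric by simp
  have neq: "head G (p ! j) \<noteq> head G (p ! k)"
    using dist jk by (simp add: distinct_conv_nth n_def)
  have mem: "head G (p ! l) \<in> tail G ` set p" if "l < n" for l
    unfolding sets using that by (simp add: n_def)
  show thesis by (rule that[OF mem[OF jk(1)] mem[OF jk(2)] neq vj vk])
qed

text \<open>A cycle enters and leaves each of its vertices through different neighbours, so
  vertices with at most one neighbour can be discarded.\<close>

lemma cycle_within_prune:
  assumes "cycle_within X"
    and "\<And>z x y. z \<in> D \<inter> X \<Longrightarrow> x \<in> X \<Longrightarrow> y \<in> X \<Longrightarrow> z \<rightarrow> x \<Longrightarrow> z \<rightarrow> y \<Longrightarrow> x = y"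
  shows "cycle_within (X - D)"
proof -
  obtain p where p: "graph_cycle G p" "tail G ` set p \<subseteq> X"
    using assms by (auto simp: cycle_within_def)
  have "v \<notin> D" if v: "v \<in> tail G ` set p" for v
  proof
    assume "v \<in> D"
    obtain x y where "x \<in> X" "y \<in> X" "x \<noteq> y" "v \<rightarrow> x" "v \<rightarrow> y"
      using graph_cycle_two_neighbours[OF p(1) v] p(2) by (metis subsetD)
    then show False using assms(2)[of v x y] v p(2) \<open>v \<in> D\<close> by auto
  qed
  then show ?thesis using p unfolding cycle_within_def by blast
qed

text \<open>A simple path from \<open>x\<close> to \<open>y\<close> inside \<open>X\<close> is
  closed up through \<open>v\<close>, which the path avoids.\<close>

lemma cycle_within_insertI:
  assumes "v \<notin> X" "X \<subseteq> verts G" "x \<noteq> y" "v \<rightarrow> x" "v \<rightarrow> y" "x \<rightarrow>\<^sup>*\<^bsub>G \<restriction> X\<^esub> y"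
  shows "cycle_within (insert v X)"
proof -
  interpret GX: wf_digraph "G \<restriction> X" by auto
  obtain p where p: "GX.apath x p y" using assms(6) GX.reachable_apath by auto
  then have apath: "apath x p y"
    using assms(2) subgraph_apath_imp_apath subgraph_induce_subgraphI by blast
  have vp: "set (awalk_verts x p) \<subseteq> X"
  proof -
    have "set (GX.awalk_verts x p) \<subseteq> verts (G \<restriction> X)"
      using p unfolding GX.apath_def by blast
    then show ?thesis by (simp add: awalk_verts_induce)
  qed
  obtain e where e: "e \<in> arcs G" "tail G e = v" "head G e = x"
    using assms(4) by auto
  obtain f where f: "f \<in> arcs G" "tail G f = y" "head G f = v"
    using graph_symmetric[OF assms(5)] by auto
  have aw: "awalk x p y" using apath by (simp add: apath_def)
  have "awalk x (p @ [f]) v" using aw f by (auto simp: awalk_simps)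
  then have w: "awalk v (e # p @ [f]) v" using e by (auto simp: awalk_Cons_iff)
  have "awalk_verts x (p @ [f]) = awalk_verts x p @ [v]"
    using awalk_verts_append[OF \<open>awalk x (p @ [f]) v\<close>] f by simp
  then have "distinct (tl (awalk_verts v (e # p @ [f])))"
    using e apath vp assms(1) by (auto simp: apath_def)
  \<comment> \<open>With at least one arc on the path, the two arcs at \<open>v\<close> bring the
    length to 3 or more.\<close>
  moreover have "p \<noteq> []" using aw assms(3) by (auto simp: awalk_Nil_iff)
  ultimately have "graph_cycle G (e # p @ [f])"
    using w by (cases p) (auto simp: graph_cycle_def cycle_def)
  moreover have "tail G ` set p \<subseteq> X" using vp by (auto simp: awalk_verts_arc1)
  moreover have "y \<in> X" 
    using vp last_in_set[OF awalk_verts_non_Nil, of x p] aw by auto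
  ultimately show ?thesis
    using e f unfolding cycle_within_def by (intro exI[of _ "e # p @ [f]"]) auto
qed

lemma triangle_cycle_within:
  assumes "a \<rightarrow> b" "b \<rightarrow> c" "a \<rightarrow> c"
  shows "cycle_within {a, b, c}"
proof (rule cycle_within_insertI[of a "{b, c}" b c])
  interpret H: wf_digraph "G \<restriction> {b, c}" by auto
  show "b \<rightarrow>\<^sup>*\<^bsub>G \<restriction> {b, c}\<^esub> c"
    using assms by (intro H.reachable_adjI) (simp add: dominates_induce_iff)
qed (use assms adj_not_same adj_in_verts in auto)

text \<open>Three clique vertices missed by \<open>F\<close> would form a triangle that survives the
  deletion of \<open>F\<close>.\<close>

lemma clique_minus_fvs_le_2:
  assumes "finite Q" "Q \<subseteq> verts G" and clique: "\<And>a b. a \<in> Q \<Longrightarrow> b \<in> Q \<Longrightarrow> a \<noteq> b \<Longrightarrow> a \<rightarrow> b"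
    and "feedback_vertex_set G F"
  shows "card Q \<le> card (Q \<inter> F) + 2"
proof (rule ccontr)
  assume "\<not> ?thesis"
  moreover have "card Q = card (Q \<inter> F) + card (Q - F)"
    using assms(1) by (metis card_Int_Diff)
  ultimately have "3 \<le> card (Q - F)" by simp
  then obtain T where T: "T \<subseteq> Q - F" "card T = 3"
    by (meson obtain_subset_with_card_n)
  then obtain a b c where abc: "T = {a, b, c}" "a \<noteq> b" "b \<noteq> c" "a \<noteq> c"
    by (auto simp: card_3_iff)
  then have "cycle_within {a, b, c}" using T clique by (intro triangle_cycle_within) auto
  then have "cycle_within (verts G - F)" using T abc assms(2) by (auto intro: cycle_within_mono)
  then show False using assms(4) by (simp add: feedback_vertex_set_iff)
qed

end

section \<open>Minimal separators\<close>

text \<open>The common setting of (ii) to (iv) for one fixed separator. Complete graphs have no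
  separator, so (i) is treated outside.\<close>

locale separated_graph = graph G for G :: "('a, 'b) pre_digraph" (structure) +
  fixes S :: "'a set"
  assumes conn: "connected G"
    and free: "induced_free (with_proj two_K2) G"
      "induced_free (with_proj (cycle_graph 4)) G"
      "induced_free (with_proj (cycle_graph 5)) G"
    and min_sep: "minimal_vertex_separator G S"
begin

abbreviation "U \<equiv> verts G - S"

text \<open>These are the vertices of the trivial components of \<open>G - S\<close>.\<close>

definition isolated :: "'a set" where
  "isolated = {t \<in> U. \<forall>u\<in>U. \<not> t \<rightarrow> u}"

lemma U_nonempty: "U \<noteq> {}"
  and separator_subset: "S \<subseteq> verts G" "finite S"
  using min_sep finite_subset[OF _ finite_verts]
  by (auto simp: minimal_vertex_separator_def vertex_separator_def)

lemma isolated_subset: "isolated \<subseteq> U"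
  by (auto simp: isolated_def)

sublocale H: sym_digraph "G \<restriction> U"
  by (rule sym_digraph_induce) auto

lemma not_connected: "\<not> connected (G \<restriction> U)"
  using min_sep
  by (auto simp: minimal_vertex_separator_def vertex_separator_def delete_verts_def)

lemma S_nonempty: "S \<noteq> {}"
  using not_connected conn by (auto simp: induce_verts)

lemma unreachable: obtains x y where "x \<in> U" "y \<in> U" "\<not> x \<rightarrow>\<^sup>*\<^bsub>G \<restriction> U\<^esub> y"
  using not_connected U_nonempty H.connected_iff_reachable by auto

text \<open>Otherwise the vertices reachable from \<open>x\<close> would still be cut off after putting \<open>v\<close> back,
  contradicting minimality.\<close>

lemma separator_neighbour:
  assumes "v \<in> S" "x \<in> U"
  obtains w where "w \<in> U" "x \<rightarrow>\<^sup>*\<^bsub>G \<restriction> U\<^esub> w" "v \<rightarrow> w"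
proof (rule ccontr)
  assume "\<not> thesis"
  with that have none: "\<not> v \<rightarrow> w" if "x \<rightarrow>\<^sup>*\<^bsub>G \<restriction> U\<^esub> w" for w
    using that H.reachable_in_verts(2)[OF that] by auto
  obtain a b where ab: "a \<in> U" "b \<in> U" "\<not> a \<rightarrow>\<^sup>*\<^bsub>G \<restriction> U\<^esub> b"
    by (rule unreachable)
  \<comment> \<open>Reachability is symmetric, so \<open>x\<close> cannot reach both
    \<open>a\<close> and \<open>b\<close>.\<close>
  then obtain y where y: "y \<in> U" "\<not> x \<rightarrow>\<^sup>*\<^bsub>G \<restriction> U\<^esub> y"
    using H.symmetric_reachable' H.reachable_trans by blast
  let ?U = "insert v U"
  have sub: "?U \<subseteq> verts G" using assms separator_subset by auto
  interpret H': sym_digraph "G \<restriction> ?U"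
    using sub by (rule sym_digraph_induce)
  have "\<not> vertex_separator G (S - {v})"
    using min_sep assms by (auto simp: minimal_vertex_separator_def)
  moreover have "verts G - (S - {v}) = ?U" using assms separator_subset by auto
  moreover have "S - {v} \<noteq> verts G" using assms separator_subset by auto
  ultimately have "connected (G \<restriction> ?U)"
    using separator_subset by (auto simp: vertex_separator_def delete_verts_def)
  then have "x \<rightarrow>\<^sup>*\<^bsub>G \<restriction> ?U\<^esub> y"
    using assms y H'.connected_iff_reachable by auto
  \<comment> \<open>The walk never leaves \<open>U\<close>: it could enter \<open>v\<close> only
    from a vertex reachable from \<open>x\<close>, and none of these is adjacent to
    \<open>v\<close>.\<close>
  then have "x \<rightarrow>\<^sup>*\<^bsub>G \<restriction> U\<^esub> y"
  proof (induction rule: H'.reachable_induct)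
    case base
    then show ?case using assms by auto
  next
    case (step a b)
    have "a \<rightarrow> b" "b \<in> ?U" using step(2) by (auto simp: dominates_induce_iff)
    moreover have "\<not> a \<rightarrow> v" using none[OF step(3)] graph_symmetric by blast
    moreover have "a \<in> U" using H.reachable_in_verts(2)[OF step(3)] by simp
    ultimately have "a \<rightarrow>\<^bsub>G \<restriction> U\<^esub> b" by (auto simp: dominates_induce_iff)
    then show ?case using step(3) H.reachable_adj_trans by blast
  qed
  then show False using y by simp
qed

text \<open>Edges in different components have no edge between them and would induce
  \<open>2K2\<close>. Hence all edges of \<open>G - S\<close> lie in one component.\<close>

lemma edges_reachable:
  assumes "a \<in> U" "b \<in> U" "c \<in> U" "d \<in> U" "a \<rightarrow> b" "c \<rightarrow> d"
  shows "a \<rightarrow>\<^sup>*\<^bsub>G \<restriction> U\<^esub> c"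
proof (rule ccontr)
  assume not: "\<not> ?thesis"
  have reach: "x \<rightarrow>\<^sup>*\<^bsub>G \<restriction> U\<^esub> y" if "x \<in> U" "y \<in> U" "x \<rightarrow> y" for x y
    using that by (intro H.reachable_adjI) (simp add: dominates_induce_iff)
  have ab: "a \<rightarrow>\<^sup>*\<^bsub>G \<restriction> U\<^esub> b" and dc: "d \<rightarrow>\<^sup>*\<^bsub>G \<restriction> U\<^esub> c"
    using assms reach graph_symmetric by blast+
  have far: "\<not> x \<rightarrow>\<^sup>*\<^bsub>G \<restriction> U\<^esub> y" if "x = a \<or> x = b" "y = c \<or> y = d" for x y
    using that ab dc not H.reachable_trans by blast
  have "a \<noteq> c" "a \<noteq> d" "b \<noteq> c" "b \<noteq> d"
    using far[of a c] far[of a d] far[of b c] far[of b d] assms by auto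
  from two_K2_free[OF free(1) assms(5,6) this] show False
    using far reach assms by blast
qed

text \<open>Of two vertices in different components, at most one can have an edge in
  \<open>G - S\<close>.\<close>

lemma isolated_nonempty: "isolated \<noteq> {}"
proof
  assume none: "isolated = {}"
  obtain x y where xy: "x \<in> U" "y \<in> U" "\<not> x \<rightarrow>\<^sup>*\<^bsub>G \<restriction> U\<^esub> y" by (rule unreachable)
  have "x \<notin> isolated" "y \<notin> isolated" using none by auto
  then obtain x' y' where "x' \<in> U" "x \<rightarrow> x'" "y' \<in> U" "y \<rightarrow> y'"
    using xy by (auto simp: isolated_def)
  then show False using edges_reachable[of x x' y y'] xy by simp
qed

lemma isolated_reachable:
  assumes "t \<in> isolated" "t \<rightarrow>\<^sup>*\<^bsub>G \<restriction> U\<^esub> w" shows "w = t"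
  using assms(2)
proof (cases rule: H.converse_reachable_cases)
  case (step z)
  then show ?thesis using assms(1) by (auto simp: dominates_induce_iff isolated_def)
qed simp

text \<open>The neighbour of \<open>v\<close> in the component of \<open>t\<close> can only be
  \<open>t\<close> itself.\<close>

lemma separator_isolated_adj:
  assumes "v \<in> S" "t \<in> isolated" shows "v \<rightarrow> t"
proof -
  have "t \<in> U" using assms(2) isolated_subset by auto
  from separator_neighbour[OF assms(1) this] obtain w
    where w: "t \<rightarrow>\<^sup>*\<^bsub>G \<restriction> U\<^esub> w" "v \<rightarrow> w" .
  then show ?thesis using isolated_reachable[OF assms(2) w(1)] by simp
qed

text \<open>With \<open>separator_isolated_adj\<close>, the neighbourhood of an isolated vertex is
  exactly \<open>S\<close>.\<close>

lemma isolated_neighbour: "t \<in> isolated \<Longrightarrow> t \<rightarrow> u \<Longrightarrow> u \<in> S"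
  using adj_in_verts(2)[of t u] by (auto simp: isolated_def)

text \<open>For non-adjacent \<open>u\<close> and \<open>v\<close>, take an isolated
  \<open>t\<close> and neighbours \<open>a\<close> of \<open>u\<close> and \<open>b\<close> of
  \<open>v\<close> in \<open>U\<close>, both different from \<open>t\<close>. A shared neighbour
  other than \<open>t\<close> closes a C4; otherwise \<open>a\<close> and \<open>b\<close> yield a
  C5 if adjacent and a \<open>2K2\<close> if not.\<close>

lemma separator_clique:
  assumes uv: "u \<in> S" "v \<in> S" "u \<noteq> v"
  shows "u \<rightarrow> v"
proof (rule ccontr)
  assume not: "\<not> u \<rightarrow> v"
  then have not': "\<not> v \<rightarrow> u" using graph_symmetric by blast
  obtain t where t: "t \<in> isolated" using isolated_nonempty by auto
  then have tU: "t \<in> U" using isolated_subset by auto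
  obtain x where x: "x \<in> U" "x \<noteq> t"
  proof -
    obtain x y where "x \<in> U" "y \<in> U" "\<not> x \<rightarrow>\<^sup>*\<^bsub>G \<restriction> U\<^esub> y" by (rule unreachable)
    moreover from this have "x \<noteq> y" by auto
    ultimately show thesis using that[of x] that[of y] by (cases "x = t") simp_all
  qed
  obtain a where a: "a \<in> U" "x \<rightarrow>\<^sup>*\<^bsub>G \<restriction> U\<^esub> a" "u \<rightarrow> a"
    using separator_neighbour[OF uv(1) x(1)] .
  obtain b where b: "b \<in> U" "x \<rightarrow>\<^sup>*\<^bsub>G \<restriction> U\<^esub> b" "v \<rightarrow> b"
    using separator_neighbour[OF uv(2) x(1)] .
  \<comment> \<open>Reaching \<open>t\<close> from \<open>x\<close> would, by symmetry, force
    \<open>x = t\<close>.\<close>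
  have "a \<noteq> t" "b \<noteq> t"
    using isolated_reachable[OF t H.symmetric_reachable'] a(2) b(2) x(2) by auto
  have tu: "t \<rightarrow> u" "u \<rightarrow> t" "t \<rightarrow> v" "v \<rightarrow> t"
    using separator_isolated_adj uv t graph_symmetric by blast+
  have au: "a \<rightarrow> u" and bv: "b \<rightarrow> v" using a b graph_symmetric by blast+
  have nt: "\<not> t \<rightarrow> a" "\<not> t \<rightarrow> b" using isolated_neighbour[OF t] a b by blast+
  \<comment> \<open>The 4-cycle is \<open>t\<close>, \<open>u\<close>, \<open>c\<close>,
    \<open>v\<close>; it has no chord from \<open>t\<close> to \<open>c\<close> because
    \<open>c\<close> lies outside \<open>S\<close>.\<close>
  have no4: "\<not> v \<rightarrow> c" if "c \<in> U" "c \<noteq> t" "u \<rightarrow> c" for c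
  proof
    assume "v \<rightarrow> c"
    then have "t \<rightarrow> c \<or> u \<rightarrow> v"
      using that tu uv graph_symmetric[OF that(3)]
      by (intro cycle_graph_4_free[OF free(2), of t u c v]) (auto intro: graph_symmetric)
    then show False using not isolated_neighbour[OF t] that by blast
  qed
  have va: "\<not> v \<rightarrow> a" and ub: "\<not> u \<rightarrow> b"
    using no4[of a] no4[of b] a b \<open>a \<noteq> t\<close> \<open>b \<noteq> t\<close> by auto
  then have "a \<noteq> b" using b by auto
  show False
  proof (cases "a \<rightarrow> b")
    case True
    have "t \<rightarrow> a \<or> t \<rightarrow> b \<or> u \<rightarrow> b \<or> u \<rightarrow> v \<or> a \<rightarrow> v"
      using tu a b bv True \<open>a \<noteq> t\<close> \<open>b \<noteq> t\<close> uv
      by (intro cycle_graph_5_free[OF free(3), of t u a b v]) auto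
    then show False using nt ub va not graph_symmetric by blast
  next
    case False
    have "u \<rightarrow> v \<or> u \<rightarrow> b \<or> a \<rightarrow> v \<or> a \<rightarrow> b"
      using a b uv \<open>a \<noteq> b\<close> by (intro two_K2_free[OF free(1)]) auto
    then show False using False ub va not graph_symmetric by blast
  qed
qed

section \<open>Lower bound from the clique, and trivial components\<close>

text \<open>The clique \<open>insert t S\<close> has one vertex more than \<open>S\<close>, and
  \<open>F\<close> misses at most two of its vertices. Bounding the intersection instead of
  \<open>F\<close> leaves room to count the part of \<open>F\<close> inside a component
  separately.\<close>

lemma fvs_separator:
  assumes "feedback_vertex_set G F" "t \<in> isolated"
  shows "card S \<le> card (insert t S \<inter> F) + 1"
proof -
  have "t \<in> verts G" "t \<notin> S" using assms(2) isolated_subset by auto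
  moreover have "card (insert t S) \<le> card (insert t S \<inter> F) + 2"
  proof (rule clique_minus_fvs_le_2)
    show "a \<rightarrow> b" if "a \<in> insert t S" "b \<in> insert t S" "a \<noteq> b" for a b
      using that separator_clique separator_isolated_adj assms(2) graph_symmetric by blast
  qed (use separator_subset assms \<open>t \<in> verts G\<close> in auto)
  ultimately show ?thesis using separator_subset by simp
qed

lemma fvs_finite: "feedback_vertex_set G F \<Longrightarrow> finite F"
  using finite_subset[OF _ finite_verts] by (auto simp: feedback_vertex_set_def)

text \<open>The clique bound already gives minimality, so (ii) and the first half of (iii) only
  require checking acyclicity.\<close>

lemma minimum_fvs_separator_minus:
  assumes "v \<in> S" "feedback_vertex_set G (S - {v})"
  shows "minimum_fvs G (S - {v})"
  unfolding minimum_fvs_def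
proof (intro conjI allI impI)
  fix F assume F: "feedback_vertex_set G F"
  obtain t where "t \<in> isolated" using isolated_nonempty by auto
  then have "card S \<le> card (insert t S \<inter> F) + 1" using F fvs_separator by blast
  moreover have "card (insert t S \<inter> F) \<le> card F"
    using fvs_finite[OF F] by (intro card_mono) auto
  ultimately show "card (S - {v}) \<le> card F" using assms(1) separator_subset by simp
qed (fact assms)

text \<open>An isolated vertex has all its neighbours in \<open>S\<close>, and \<open>X\<close>
  keeps at most one vertex of \<open>S\<close>.\<close>

lemma prune_isolated:
  assumes "cycle_within X" "X \<inter> S \<subseteq> {v}"
  shows "cycle_within (X - isolated)"
  using assms(1)
proof (rule cycle_within_prune)
  fix z x y assume "z \<in> isolated \<inter> X" "x \<in> X" "y \<in> X" "z \<rightarrow> x" "z \<rightarrow> y"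
  then show "x = y" using isolated_neighbour[of z] assms(2) by auto
qed

lemma minimum_fvs_trivial_components:
  assumes triv: "\<forall>C\<in>pre_digraph.sccs (G \<restriction> U). trivial_component C"
  obtains v where "v \<in> S" "minimum_fvs G (S - {v})"
proof -
  have U_eq: "U = isolated"
  proof (intro equalityI subsetI)
    fix t assume t: "t \<in> U"
    have "\<not> t \<rightarrow> u" if u: "u \<in> U" for u
    proof
      assume tu: "t \<rightarrow> u"
      \<comment> \<open>\<open>?R\<close> is the vertex set of the component of \<open>t\<close>;
        triviality would identify \<open>t\<close> with its neighbour \<open>u\<close>.\<close>
      let ?R = "{v. t \<rightarrow>\<^sup>*\<^bsub>G \<restriction> U\<^esub> v}"
      have "t \<rightarrow>\<^sup>*\<^bsub>G \<restriction> U\<^esub> u"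
        using t u tu by (intro H.reachable_adjI) (simp add: dominates_induce_iff)
      then have "t \<in> ?R" "u \<in> ?R" using t by auto
      moreover have "(G \<restriction> U) \<restriction> ?R \<in> H.sccs"
        using t by (intro H.induce_reachable_is_in_sccs) simp
      then have "card ?R = 1" using triv by (auto simp: trivial_component_def)
      then obtain z where "?R = {z}" by (rule card_1_singletonE)
      ultimately have "t = u" by (metis singletonD)
      then show False using tu adj_not_same by auto
    qed
    then show "t \<in> isolated" using t by (simp add: isolated_def)
  qed (use isolated_subset in auto)
  obtain v where v: "v \<in> S" using S_nonempty by auto
  have "\<not> cycle_within (verts G - (S - {v}))"
  proof
    assume "cycle_within (verts G - (S - {v}))"
    then have "cycle_within (verts G - (S - {v}) - isolated)"
      by (rule prune_isolated[of _ v]) auto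
    moreover have "verts G - (S - {v}) - isolated = {v}" using v separator_subset U_eq by auto
    \<comment> \<open>A second pruning removes \<open>v\<close>, which has no loop.\<close>
    ultimately have "cycle_within ({v} - {v})"
      by (intro cycle_within_prune) (use adj_not_same in auto)
    then show False by (simp add: not_cycle_within_empty)
  qed
  then have "feedback_vertex_set G (S - {v})" using separator_subset by (auto simp: feedback_vertex_set_iff)
  then show thesis using that v minimum_fvs_separator_minus by blast
qed

section \<open>Nontrivial components\<close>

text \<open>\<open>C\<close> contains an edge, so by \<open>edges_reachable\<close> every vertex
  with an edge in \<open>G - S\<close> belongs to it. Thus \<open>U\<close> splits into
  \<open>verts C\<close> and isolated vertices.\<close>

lemma nontrivial_component:
  assumes "C \<in> pre_digraph.sccs (G \<restriction> U)" "\<not> trivial_component C"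
  shows "verts C \<subseteq> U" "C = G \<restriction> verts C" "U - verts C \<subseteq> isolated" "U - verts C \<noteq> {}"
    "\<And>x y. x \<in> verts C \<Longrightarrow> y \<in> verts C \<Longrightarrow> x \<rightarrow>\<^sup>*\<^bsub>G \<restriction> verts C\<^esub> y"
    "verts C \<inter> isolated = {}"
proof -
  let ?W = "verts C"
  have ind: "induced_subgraph C (G \<restriction> U)" and sc: "strongly_connected C"
    using assms(1) by (auto simp: H.sccs_def)
  show W: "?W \<subseteq> U" using ind by (auto simp: induced_subgraph_def subgraph_def)
  then show C: "C = G \<restriction> ?W"
    using induced_subgraph_eq_induce[OF ind] by (simp add: induce_subgraph_induce)
  show reach: "x \<rightarrow>\<^sup>*\<^bsub>G \<restriction> ?W\<^esub> y" if "x \<in> ?W" "y \<in> ?W" for x y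
    using that sc C by (auto simp: strongly_connected_def)
  then have reachU: "x \<rightarrow>\<^sup>*\<^bsub>G \<restriction> U\<^esub> y" if "x \<in> ?W" "y \<in> ?W" for x y
    using that W reachable_induce_ss by blast
  have closed: "y \<in> ?W" if "x \<in> ?W" "x \<rightarrow>\<^sup>*\<^bsub>G \<restriction> U\<^esub> y" for x y
  proof -
    have "?W \<in> H.sccs_verts" using assms(1) H.in_sccs_vertsI_sccs by blast
    then show ?thesis
      using that H.symmetric_reachable' unfolding H.in_sccs_verts_conv_reachable by blast
  qed
  have "?W \<noteq> {}" using sc by (auto simp: strongly_connected_def)
  \<comment> \<open>Take the first step of a path towards another vertex of the component.\<close>
  have edge: "\<exists>z\<in>?W. x \<rightarrow> z" if x: "x \<in> ?W" for x
  proof -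
    have "?W \<noteq> {x}" using assms(2) by (auto simp: trivial_component_def)
    then obtain y where y: "y \<in> ?W" "y \<noteq> x" using x by auto
    interpret W: wf_digraph "G \<restriction> ?W" by auto
    from reach[OF x y(1)] show ?thesis
    proof (cases rule: W.converse_reachable_cases)
      case base
      then show ?thesis using y by simp
    next
      case (step z)
      then show ?thesis by (auto simp: dominates_induce_iff)
    qed
  qed
  then show "?W \<inter> isolated = {}" using W by (auto simp: isolated_def)
  show "U - ?W \<subseteq> isolated"
  proof
    fix z assume z: "z \<in> U - ?W"
    have "\<not> z \<rightarrow> u" if u: "u \<in> U" for u
    proof
      assume zu: "z \<rightarrow> u"
      obtain x x' where "x \<in> ?W" "x' \<in> ?W" "x \<rightarrow> x'" using \<open>?W \<noteq> {}\<close> edge by blast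
      then show False using closed edges_reachable[of x x' z u] zu u z W by auto
    qed
    then show "z \<in> isolated" using z by (auto simp: isolated_def)
  qed
  show "U - ?W \<noteq> {}"
  proof
    assume "U - ?W = {}"
    then have "?W = U" using W by auto
    then show False using reachU unreachable by metis
  qed
qed

text \<open>Two neighbours of \<open>v\<close> are joined by a path inside the component, which
  \<open>v\<close> closes to a cycle.\<close>

lemma component_insert_cycle:
  assumes C: "C \<in> pre_digraph.sccs (G \<restriction> U)" "\<not> trivial_component C"
    and v: "v \<in> S" "2 \<le> card (neighbourhood G v \<inter> verts C)"
  shows "cycle_within (insert v (verts C))"
proof -
  note * = nontrivial_component[OF C]
  obtain T where "T \<subseteq> neighbourhood G v \<inter> verts C" "card T = 2"
    using v(2) by (meson obtain_subset_with_card_n)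
  then obtain x y where "x \<noteq> y" "x \<in> verts C" "y \<in> verts C" "v \<rightarrow> x" "v \<rightarrow> y"
    by (auto simp: card_2_iff neighbourhood_def)
  then show ?thesis
    using *(1,5) v(1) by (intro cycle_within_insertI[of v _ x y]) auto
qed

lemma minimum_fvs_tree_component_unique_neighbour:
  assumes C: "C \<in> pre_digraph.sccs (G \<restriction> U)" "\<not> trivial_component C" and tree: "graph_tree C"
    and v: "v \<in> S" "card (neighbourhood G v \<inter> verts C) = 1"
  shows "minimum_fvs G (S - {v})"
proof (rule minimum_fvs_separator_minus[OF v(1)])
  note * = nontrivial_component[OF C]
  have vU: "v \<notin> verts C" "v \<notin> isolated" using v(1) *(1) isolated_subset by auto
  obtain w where w: "neighbourhood G v \<inter> verts C = {w}" using v(2) by (auto simp: card_1_singleton_iff)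
  have "\<not> cycle_within (verts G - (S - {v}))"
  proof
    assume "cycle_within (verts G - (S - {v}))"
    then have "cycle_within (verts G - (S - {v}) - isolated)"
      by (rule prune_isolated[of _ v]) auto
    moreover have "verts G - (S - {v}) - isolated = insert v (verts C)"
      using v(1) separator_subset *(1,3,6) vU by blast
    \<comment> \<open>Once the isolated vertices are gone, \<open>w\<close> is the only neighbour of
      \<open>v\<close>, so \<open>v\<close> can be pruned too and only the tree remains.\<close>
    moreover have "z = w" if "z \<in> insert v (verts C)" "v \<rightarrow> z" for z
      using that w adj_not_same by (auto simp: neighbourhood_def)
    ultimately have "cycle_within (insert v (verts C) - {v})"
      by (intro cycle_within_prune) auto
    then have "cycle_within (verts C)" using vU by simp
    moreover have "graph_forest (G \<restriction> verts C)" using tree *(2) by (simp add: graph_tree_def)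
    ultimately show False using graph_forest_induce_iff *(1) by auto
  qed
  then show "feedback_vertex_set G (S - {v})" using separator_subset by (auto simp: feedback_vertex_set_iff)
qed

text \<open>A feedback vertex set smaller than \<open>S\<close> would be used up on the clique
  \<open>insert t S\<close>. It would then miss all of \<open>C\<close> and some \<open>v\<close> in
  \<open>S\<close>, which together carry a cycle.\<close>

lemma minimum_fvs_tree_component_two_neighbours:
  assumes C: "C \<in> pre_digraph.sccs (G \<restriction> U)" "\<not> trivial_component C" and tree: "graph_tree C"
    and two: "\<forall>v\<in>S. 2 \<le> card (neighbourhood G v \<inter> verts C)"
  shows "minimum_fvs G S"
  unfolding minimum_fvs_def
proof (intro conjI allI impI)
  note * = nontrivial_component[OF C]
  have "\<not> cycle_within U"
  proof
    assume "cycle_within U"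
    \<comment> \<open>\<open>U\<close> contains no vertex of \<open>S\<close>, so any value serves
      as the exceptional vertex; hence \<open>undefined\<close>.\<close>
    then have "cycle_within (U - isolated)" by (rule prune_isolated[of _ undefined]) auto
    moreover have "U - isolated = verts C" using *(1,3,6) by blast
    moreover have "graph_forest (G \<restriction> verts C)" using tree *(2) by (simp add: graph_tree_def)
    ultimately show False using graph_forest_induce_iff *(1) by auto
  qed
  then show "feedback_vertex_set G S" using separator_subset by (simp add: feedback_vertex_set_iff)
  fix F assume F: "feedback_vertex_set G F"
  have finF: "finite F" using F by (rule fvs_finite)
  show "card S \<le> card F"
  proof (rule ccontr)
    assume less: "\<not> card S \<le> card F"
    obtain t where t: "t \<in> isolated" using isolated_nonempty by auto
    have "card F \<le> card (insert t S \<inter> F)" using fvs_separator[OF F t] less by simp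
    then have "F \<subseteq> insert t S"
      using card_seteq[of F "insert t S \<inter> F"] finF by auto
    moreover have "\<not> S \<subseteq> F" using less finF card_mono by blast
    then obtain v where v: "v \<in> S" "v \<notin> F" by auto
    ultimately have "insert v (verts C) \<subseteq> verts G - F" using *(1,6) t separator_subset by blast
    moreover have "cycle_within (insert v (verts C))"
      using component_insert_cycle[OF C v(1)] two v by auto
    ultimately show False using F cycle_within_mono by (auto simp: feedback_vertex_set_iff)
  qed
qed

text \<open>For each \<open>j\<close>, adding \<open>S - {j}\<close> to an optimal set for
  \<open>C\<close> with \<open>j\<close> gives a feedback vertex set after pruning. Conversely, an
  optimal set of \<open>G\<close> is split into its part in \<open>C\<close> with a suitable
  \<open>j\<close> and a disjoint part of size at least \<open>card S - 1\<close>.\<close>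

lemma fvs_nontrivial_component:
  assumes C: "C \<in> pre_digraph.sccs (G \<restriction> U)" "\<not> trivial_component C"
  shows "fvs G = (MIN j\<in>S. card (S - {j}) + fvs (G \<restriction> (verts C \<union> {j})))"
proof -
  note * = nontrivial_component[OF C]
  let ?f = "\<lambda>j. card (S - {j}) + fvs (G \<restriction> (verts C \<union> {j}))"
  have sub: "verts C \<union> {j} \<subseteq> verts G" if "j \<in> S" for j using that separator_subset *(1) by auto
  have ub: "fvs G \<le> ?f j" if j: "j \<in> S" for j
  proof -
    obtain F where F: "feedback_vertex_set (G \<restriction> (verts C \<union> {j})) F"
      "card F = fvs (G \<restriction> (verts C \<union> {j}))"
      using fvs_attained by blast
    then have F': "F \<subseteq> verts C \<union> {j}" "\<not> cycle_within (verts C \<union> {j} - F)"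
      using feedback_vertex_set_induce_iff[OF sub[OF j]] by auto
    let ?F = "S - {j} \<union> F"
    have "\<not> cycle_within (verts G - ?F)"
    proof
      assume "cycle_within (verts G - ?F)"
      then have "cycle_within (verts G - ?F - isolated)"
        by (rule prune_isolated[of _ j]) auto
      moreover have "verts G - ?F - isolated \<subseteq> verts C \<union> {j} - F" using *(3) by blast
      ultimately show False using F' cycle_within_mono by blast
    qed
    then have "feedback_vertex_set G ?F" using F' separator_subset sub[OF j] by (auto simp: feedback_vertex_set_iff)
    then have "fvs G \<le> card ?F" by (rule fvs_le)
    also have "\<dots> \<le> card (S - {j}) + card F" by (rule card_Un_le)
    finally show ?thesis using F by simp
  qed
  have lb: "\<exists>j\<in>S. ?f j \<le> fvs G"
  proof -
    obtain F where F: "feedback_vertex_set G F" "card F = fvs G" using fvs_attained by blast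
    have finF: "finite F" using F(1) by (rule fvs_finite)
    obtain t where t: "t \<in> isolated" using isolated_nonempty by auto
    have tC: "t \<notin> verts C" "t \<notin> S" using t *(6) isolated_subset by auto
    \<comment> \<open>Choose a vertex of \<open>S\<close> missed by \<open>F\<close> if there is
      one, and any vertex of \<open>S\<close> otherwise.\<close>
    obtain j where j: "j \<in> S" and jF: "S \<subseteq> F \<or> j \<notin> F" using S_nonempty by blast
    let ?F = "F \<inter> (verts C \<union> {j})"
    have "verts C \<union> {j} - ?F \<subseteq> verts G - F" using sub[OF j] by auto
    then have "\<not> cycle_within (verts C \<union> {j} - ?F)"
      using F(1) cycle_within_mono by (auto simp only: feedback_vertex_set_iff)
    then have "feedback_vertex_set (G \<restriction> (verts C \<union> {j})) ?F"
      unfolding feedback_vertex_set_induce_iff[OF sub[OF j]] by blast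
    then have F_j: "fvs (G \<restriction> (verts C \<union> {j})) \<le> card ?F" by (rule fvs_le)
    show ?thesis
    proof (cases "S \<subseteq> F")
      case True
      have "card (S - {j}) + card ?F \<le> card F"
      proof -
        have "card (S - {j}) + card ?F = card ((S - {j}) \<union> ?F)"
          using separator_subset finF *(1) by (intro card_Un_disjoint[symmetric]) auto
        also have "\<dots> \<le> card F" using True finF by (intro card_mono) auto
        finally show ?thesis .
      qed
      then show ?thesis using F_j F(2) j by (intro bexI[of _ j]) auto
    next
      case False
      then have "j \<notin> F" using jF by simp
      have "card S \<le> card (insert t S \<inter> F) + 1" using F(1) t by (rule fvs_separator)
      \<comment> \<open>The two parts are disjoint: \<open>insert t S\<close> meets
        \<open>verts C \<union> {j}\<close> only in \<open>j\<close>, which is not in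
        \<open>F\<close>.\<close>
      moreover have "card (insert t S \<inter> F) + card ?F \<le> card F"
      proof -
        have "card (insert t S \<inter> F) + card ?F = card (insert t S \<inter> F \<union> ?F)"
          using finF *(1) tC \<open>j \<notin> F\<close> by (intro card_Un_disjoint[symmetric]) auto
        also have "\<dots> \<le> card F" using finF by (intro card_mono) auto
        finally show ?thesis .
      qed
      ultimately show ?thesis using F_j F(2) j separator_subset by (intro bexI[of _ j]) auto
    qed
  qed
  have "Min (?f ` S) = fvs G"
  proof (rule Min_eqI)
    obtain j where "j \<in> S" "?f j \<le> fvs G" using lb by auto
    then have "fvs G = ?f j" using ub by (simp add: order_antisym)
    then show "fvs G \<in> ?f ` S" using \<open>j \<in> S\<close> by blast
  qed (use ub separator_subset in auto)
  then show ?thesis by simp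
qed

end

section \<open>Complete graphs and the combined statement\<close>

lemma (in graph) minimum_fvs_complete:
  assumes "complete_digraph n G" "verts G \<noteq> {}"
  obtains x y where "x \<in> verts G" "y \<in> verts G" "minimum_fvs G (verts G - {x, y})"
proof -
  have adj: "x \<rightarrow> y" if "x \<in> verts G" "y \<in> verts G" "x \<noteq> y" for x y
    using assms(1) that by (auto simp: complete_digraph_def)
  \<comment> \<open>\<open>x = y\<close> occurs only for the one-vertex graph, where the set to be
    deleted is empty.\<close>
  obtain x y where xy: "x \<in> verts G" "y \<in> verts G" "x = y \<longrightarrow> verts G = {x}"
    using assms(2) by blast
  have "\<not> cycle_within {x, y}"
  proof
    assume "cycle_within {x, y}"
    \<comment> \<open>Each of the two vertices has at most the other as neighbour, so both can be
      pruned.\<close>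
    then have "cycle_within ({x, y} - {x, y})"
      by (rule cycle_within_prune) (use adj_not_same in auto)
    then show False by (simp add: not_cycle_within_empty)
  qed
  then have "feedback_vertex_set G (verts G - {x, y})"
    using xy by (simp add: feedback_vertex_set_iff Diff_Diff_Int Int_absorb1)
  moreover have "card (verts G - {x, y}) \<le> card F" if F: "feedback_vertex_set G F" for F
  proof -
    have "F \<subseteq> verts G" using F by (simp add: feedback_vertex_set_def)
    then have "verts G \<inter> F = F" by auto
    then have "card (verts G) \<le> card F + 2"
      using clique_minus_fvs_le_2[OF finite_verts order_refl adj F] by simp
    then show ?thesis
      using xy by (cases "x = y") (auto simp: card_Diff_subset)
  qed
  ultimately show thesis using that xy by (auto simp: minimum_fvs_def)
qed

theorem theorem10:
  fixes G :: "('a, 'b) pre_digraph"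
  assumes "graph G" and "connected G"
    and "induced_free (with_proj two_K2) G"
    and "induced_free (with_proj (cycle_graph 4)) G"
    and "induced_free (with_proj (cycle_graph 5)) G"
  shows
    "(complete_digraph (card (verts G)) G \<longrightarrow>
        (\<exists>x\<in>verts G. \<exists>y\<in>verts G. minimum_fvs G (verts G - {x, y}))) \<and>
     (\<forall>S. minimal_vertex_separator G S \<longrightarrow>
        ((\<forall>C\<in>pre_digraph.sccs (delete_verts G S). trivial_component C) \<longrightarrow>
           (\<exists>v\<in>S. minimum_fvs G (S - {v}))) \<and>
        (\<forall>G1\<in>pre_digraph.sccs (delete_verts G S).
           \<not> trivial_component G1 \<and> graph_tree G1 \<longrightarrow>
             (\<forall>v\<in>S. card (neighbourhood G v \<inter> verts G1) = 1 \<longrightarrow> minimum_fvs G (S - {v})) \<and>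
             ((\<forall>v\<in>S. 2 \<le> card (neighbourhood G v \<inter> verts G1)) \<longrightarrow> minimum_fvs G S)) \<and>
        (\<forall>G1\<in>pre_digraph.sccs (delete_verts G S).
           \<not> trivial_component G1 \<and> (\<exists>p. graph_cycle G1 p) \<longrightarrow>
             fvs G = (MIN j\<in>S. card (S - {j}) + fvs (G \<restriction> (verts G1 \<union> {j})))))"
proof -
  interpret graph G by fact
  have separated: "separated_graph G S" if "minimal_vertex_separator G S" for S
    by (intro separated_graph.intro separated_graph_axioms.intro assms that)
  show ?thesis
  proof (intro conjI impI allI ballI)
    assume "complete_digraph (card (verts G)) G"
    moreover have "verts G \<noteq> {}" using assms(2) by (simp add: connected_iff_reachable)
    ultimately obtain x y where "x \<in> verts G" "y \<in> verts G" "minimum_fvs G (verts G - {x, y})"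
      by (rule minimum_fvs_complete)
    then show "\<exists>x\<in>verts G. \<exists>y\<in>verts G. minimum_fvs G (verts G - {x, y})" by blast
  next
    fix S
    assume "minimal_vertex_separator G S"
      and "\<forall>C\<in>pre_digraph.sccs (delete_verts G S). trivial_component C"
    then obtain v where "v \<in> S" "minimum_fvs G (S - {v})"
      using separated_graph.minimum_fvs_trivial_components[OF separated]
      unfolding delete_verts_def by metis
    then show "\<exists>v\<in>S. minimum_fvs G (S - {v})" by blast
  next
    fix S C v
    assume "minimal_vertex_separator G S" "C \<in> pre_digraph.sccs (delete_verts G S)"
      "\<not> trivial_component C \<and> graph_tree C" "v \<in> S" "card (neighbourhood G v \<inter> verts C) = 1"
    then show "minimum_fvs G (S - {v})"
      unfolding delete_verts_def
      by (intro separated_graph.minimum_fvs_tree_component_unique_neighbour[OF separated]) auto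
  next
    fix S C
    assume "minimal_vertex_separator G S" "C \<in> pre_digraph.sccs (delete_verts G S)"
      "\<not> trivial_component C \<and> graph_tree C"
      "\<forall>v\<in>S. 2 \<le> card (neighbourhood G v \<inter> verts C)"
    then show "minimum_fvs G S"
      unfolding delete_verts_def
      by (intro separated_graph.minimum_fvs_tree_component_two_neighbours[OF separated]) auto
  next
    fix S C
    assume "minimal_vertex_separator G S" "C \<in> pre_digraph.sccs (delete_verts G S)"
      "\<not> trivial_component C \<and> (\<exists>p. graph_cycle C p)"
    then show "fvs G = (MIN j\<in>S. card (S - {j}) + fvs (G \<restriction> (verts C \<union> {j})))"
      unfolding delete_verts_def
      by (intro separated_graph.fvs_nontrivial_component[OF separated]) auto
  qed
qed

end
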